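(* Let $X,Y$ be compact intervals of the real line and let $T=(f,g):X\times Y\to X\times Y$, $T(x,y)=(f(x),g(x,y))$, be a continuous triangular map. Suppose that the basis map $f$ is unimodal and its critical point has a periodic orbit $P$ of finite period $p$, and that the map $g_P:Y\to Y$ is $m$-modal and its $m$ critical points have periodic orbits $Q_1,\dots,Q_m$ of finite periods $q_1,\dots,q_m$. Let $\mathcal{R}_x,\mathcal{R}_y$ and $A_x,A_y$ be the Markov partitions and transition matrices associated with $f$ and $g_P$, respectively, and let $T_P(x,y)=(f(x),g_P(y))$. Then the Markov partition of the map $T_P$ is given by the cartesian product $\mathcal{R}_x\times\mathcal{R}_y$, and the transition matrix $A$ of $T_P$ is given by the tensor product $$A=A_y\otimes A_x.$$
   Context: A continuous triangular map is a continuous map $T:X\times Y\to X\times Y$ of the form $T(x,y)=(f(x),g(x,y))$; $f$ is the basis map and $g$ the fiber map. For a $p$-periodic orbit $P=\{x_0,\dots,x_{p-1}\}$ of $f$, labelled so that $f(x_i)=x_{i+1}$ for $0\le i\le p-2$ and $f(x_{p-1})=x_0$, define $g_P:Y\to Y$ by $g_P(y)=g(x_{p-1},g(x_{p-2},\dots,g(x_1,g(x_0,y))\dots))$. An $m$-modal map is a continuous map of a compact interval into itself with exactly $m$ interior turning (critical) points, strictly monotone on each of the $m+1$ laps they determine; unimodal means $m=1$. By convention the first and last critical points are maxima. The Markov partition $\mathcal{R}_x$ associated with $f$ consists of the closed intervals $X_1,X_2,\dots$ (listed from left to right) whose endpoints are consecutive points of the critical orbit $P$ of $f$; the Markov partition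 $\mathcal{R}_y$ associated with $g_P$ consists of the closed intervals $Y_1,Y_2,\dots$ (listed from left to right) whose endpoints are consecutive points of $Q_1\cup\dots\cup Q_m$. The product $\mathcal{R}_x\times\mathcal{R}_y$ is the family of rectangles $X_i\times Y_j$. A family of rectangles being a Markov partition for $T_P$ means that the rectangles have pairwise disjoint interiors and the image under $T_P$ of each rectangle, for each rectangle $R_j$ of the family, either fully covers $R_j$ or misses it (has interior disjoint from the interior of $R_j$). Given a Markov partition $\{R_j\}$ of a map $F$, its transition matrix is $(a_{ij})$ with $a_{ij}=1$ if $\mathrm{int}(F(R_i))\cap \mathrm{int}(R_j)\ne\emptyset$ and $a_{ij}=0$ otherwise. For $T_P$ the rectangles are ordered lexicographically with the $y$-index first, i.e. $X_1\times Y_1,X_2\times Y_1,\dots,X_1\times Y_2,X_2\times Y_2,\dots$. The tensor (Kronecker) product of matrices is $B\otimes C=[b_{ij}C]$ (block matrix with $(i,j)$ block $b_{ij}C$). *)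

theory Defs
  imports "HOL-Analysis.Analysis" "Jordan_Normal_Form.Matrix"
begin

section \<open>Triangular maps and periodic orbits\<close>

definition triangular :: "(real \<Rightarrow> real) \<Rightarrow> (real \<Rightarrow> real \<Rightarrow> real) \<Rightarrow> real \<times> real \<Rightarrow> real \<times> real" where
  "triangular f g = (\<lambda>(x, y). (f x, g x y))"

definition continuous_self_map :: "'a::topological_space set \<Rightarrow> ('a \<Rightarrow> 'a) \<Rightarrow> bool" where
  "continuous_self_map S F \<longleftrightarrow> continuous_on S F \<and> F ` S \<subseteq> S"

text \<open>
  \<open>x 0, \<dots>, x (p - 1)\<close> are the points of a periodic orbit of least period \<open>p\<close>, labelled in
  the order in which \<open>f\<close> visits them, starting at an arbitrary point of the orbit.
\<close>

definition orbit_labelling :: "(real \<Rightarrow> real) \<Rightarrow> nat \<Rightarrow> (nat \<Rightarrow> real) \<Rightarrow> bool" where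
  "orbit_labelling f p x \<longleftrightarrow>
     0 < p \<and> inj_on x {..<p} \<and> (\<forall>i<p. f (x i) = x (Suc i mod p))"

definition periodic_orbit :: "(real \<Rightarrow> real) \<Rightarrow> nat \<Rightarrow> real set \<Rightarrow> bool" where
  "periodic_orbit f p P \<longleftrightarrow> (\<exists>x. orbit_labelling f p x \<and> P = x ` {..<p})"

text \<open>The map \<open>y \<mapsto> g (x (p - 1)) (\<dots> (g (x 1) (g (x 0) y)) \<dots>)\<close>; \<open>x 0\<close> acts first.\<close>

definition fiber_composition ::
    "(real \<Rightarrow> real \<Rightarrow> real) \<Rightarrow> nat \<Rightarrow> (nat \<Rightarrow> real) \<Rightarrow> real \<Rightarrow> real" where
  "fiber_composition g p x = fold (\<lambda>i. g (x i)) [0..<p]"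


section \<open>Modal maps\<close>

text \<open>
  The closed intervals between consecutive points of a finite set, from left to right.
  A set with at most one point yields the empty list.
\<close>

definition consecutive_intervals :: "real set \<Rightarrow> real set list" where
  "consecutive_intervals S =
     (let s = sorted_list_of_set S in map (\<lambda>i. {s ! i .. s ! Suc i}) [0..<card S - 1])"

definition local_max_at :: "(real \<Rightarrow> real) \<Rightarrow> real \<Rightarrow> bool" where
  "local_max_at f z \<longleftrightarrow> (\<forall>\<^sub>F u in at z. f u \<le> f z)"

definition local_min_at :: "(real \<Rightarrow> real) \<Rightarrow> real \<Rightarrow> bool" where
  "local_min_at f z \<longleftrightarrow> (\<forall>\<^sub>F u in at z. f z \<le> f u)"

text \<open>
  Only interior points count, so neighbourhoods of \<open>z\<close> may be taken inside \<open>{a..b}\<close> and the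
  values of \<open>f\<close> outside \<open>{a..b}\<close> do not matter.
\<close>

definition turning_points :: "(real \<Rightarrow> real) \<Rightarrow> real \<Rightarrow> real \<Rightarrow> real set" where
  "turning_points f a b = {z \<in> {a<..<b}. local_max_at f z \<or> local_min_at f z}"

text \<open>
  The laps are the intervals cut out of \<open>{a..b}\<close> by the turning points. The last conjunct is the
  convention that the first and the last turning points are maxima.
\<close>

definition modal :: "nat \<Rightarrow> (real \<Rightarrow> real) \<Rightarrow> real \<Rightarrow> real \<Rightarrow> bool" where
  "modal m f a b \<longleftrightarrow>
     continuous_self_map {a..b} f \<and>
     finite (turning_points f a b) \<and> card (turning_points f a b) = m \<and>
     (\<forall>L \<in> set (consecutive_intervals ({a, b} \<union> turning_points f a b)).
        strict_mono_on L f \<or> strict_antimono_on L f) \<and>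
     (turning_points f a b \<noteq> {} \<longrightarrow>
        local_max_at f (Min (turning_points f a b)) \<and>
        local_max_at f (Max (turning_points f a b)))"

abbreviation unimodal :: "(real \<Rightarrow> real) \<Rightarrow> real \<Rightarrow> real \<Rightarrow> bool" where
  "unimodal \<equiv> modal 1"


section \<open>Markov partitions and transition matrices\<close>

definition is_markov_partition ::
    "('a::topological_space \<Rightarrow> 'a) \<Rightarrow> 'a set list \<Rightarrow> bool" where
  "is_markov_partition F Rs \<longleftrightarrow>
     (\<forall>i<length Rs. \<forall>j<length Rs. i \<noteq> j \<longrightarrow> interior (Rs ! i) \<inter> interior (Rs ! j) = {}) \<and>
     (\<forall>i<length Rs. \<forall>j<length Rs.
        Rs ! j \<subseteq> F ` (Rs ! i) \<or> interior (F ` (Rs ! i)) \<inter> interior (Rs ! j) = {})"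

definition transition_matrix ::
    "('a::topological_space \<Rightarrow> 'a) \<Rightarrow> 'a set list \<Rightarrow> real mat" where
  "transition_matrix F Rs =
     mat (length Rs) (length Rs)
       (\<lambda>(i, j). if interior (F ` (Rs ! i)) \<inter> interior (Rs ! j) \<noteq> {} then 1 else 0)"

text \<open>The order is \<open>X\<^sub>1 \<times> Y\<^sub>1, X\<^sub>2 \<times> Y\<^sub>1, \<dots>, X\<^sub>1 \<times> Y\<^sub>2, X\<^sub>2 \<times> Y\<^sub>2, \<dots>\<close>.\<close>

definition product_partition :: "'a set list \<Rightarrow> 'b set list \<Rightarrow> ('a \<times> 'b) set list" where
  "product_partition Xs Ys = concat (map (\<lambda>Y. map (\<lambda>X. X \<times> Y) Xs) Ys)"

text \<open>The block matrix whose \<open>(i, j)\<close> block is \<open>B $$ (i, j)\<close> times \<open>C\<close>.\<close>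

definition kronecker :: "'a::times mat \<Rightarrow> 'a mat \<Rightarrow> 'a mat" where
  "kronecker B C =
     mat (dim_row B * dim_row C) (dim_col B * dim_col C)
       (\<lambda>(i, j). B $$ (i div dim_row C, j div dim_col C) * C $$ (i mod dim_row C, j mod dim_col C))"

end

theory Submission
  imports Defs
begin

text \<open>
  The orbit points form a finite invariant set containing every turning point. An interval between
  consecutive orbit points therefore lies in a single lap, and its image is an interval whose
  endpoints are again orbit points, hence a union of partition intervals. For \<open>T\<^sub>P\<close>, images,
  inclusions and interiors of rectangles all split into the two coordinates.
\<close>

section \<open>Intervals between consecutive points of a finite set\<close>

lemma length_consecutive_intervals: "length (consecutive_intervals S) = card S - 1"
  by (simp add: consecutive_intervals_def Let_def)

lemma nth_consecutive_intervals:
  "i < card S - 1 \<Longrightarrow> consecutive_intervals S ! i =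
    {sorted_list_of_set S ! i .. sorted_list_of_set S ! Suc i}"
  by (simp add: consecutive_intervals_def Let_def)

lemma sorted_list_of_set_index:
  assumes "finite S" "z \<in> S"
  obtains k where "k < card S" "sorted_list_of_set S ! k = z"
proof -
  have "z \<in> set (sorted_list_of_set S)" using assms by simp
  then show ?thesis
    using that assms(1) by (auto simp only: in_set_conv_nth length_sorted_list_of_set)
qed

lemma sorted_list_of_set_gap:
  fixes S :: "'a::linorder set"
  assumes "finite S" "Suc i < card S"
  shows "sorted_list_of_set S ! i < sorted_list_of_set S ! Suc i"
    and "S \<inter> {sorted_list_of_set S ! i <..< sorted_list_of_set S ! Suc i} = {}"
proof -
  let ?s = "sorted_list_of_set S"
  have sorted: "sorted_wrt (<) ?s" and len: "length ?s = card S"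
    using assms(1) by auto
  show "?s ! i < ?s ! Suc i"
    using sorted_wrt_nth_less[OF sorted, of i "Suc i"] assms(2) len by simp
  have outside: "z \<le> ?s ! i \<or> ?s ! Suc i \<le> z" if "z \<in> S" for z
  proof -
    obtain k where k: "k < card S" "?s ! k = z"
      using sorted_list_of_set_index[OF assms(1) \<open>z \<in> S\<close>] .
    show ?thesis
    proof (cases "k \<le> i")
      case True
      then have "?s ! k \<le> ?s ! i"
        using assms(2) len by (intro sorted_nth_mono) auto
      then show ?thesis using k by blast
    next
      case False
      then have "?s ! Suc i \<le> ?s ! k"
        using k(1) len by (intro sorted_nth_mono) auto
      then show ?thesis using k by blast
    qed
  qed
  show "S \<inter> {?s ! i <..< ?s ! Suc i} = {}"
  proof (intro equals0I)
    fix z assume "z \<in> S \<inter> {?s ! i <..< ?s ! Suc i}"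
    then show False
      using outside[of z] by (auto dest: leD)
  qed
qed

lemma consecutive_intervals_nth_obtain:
  assumes "finite S" "i < length (consecutive_intervals S)"
  obtains u v where "consecutive_intervals S ! i = {u..v}" "u \<in> S" "v \<in> S" "u < v"
    "S \<inter> {u<..<v} = {}"
proof
  let ?s = "sorted_list_of_set S"
  have i: "i < card S - 1" "Suc i < card S"
    using assms(2) by (auto simp: length_consecutive_intervals)
  show "consecutive_intervals S ! i = {?s ! i .. ?s ! Suc i}"
    using i by (simp add: nth_consecutive_intervals)
  show "?s ! i \<in> S" "?s ! Suc i \<in> S"
    using i nth_mem[of i ?s] nth_mem[of "Suc i" ?s] assms(1) by simp_all
  show "?s ! i < ?s ! Suc i" "S \<inter> {?s ! i <..< ?s ! Suc i} = {}"
    using sorted_list_of_set_gap[OF assms(1) i(2)] .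
qed

text \<open>Applied with \<open>U\<close> the lap endpoints, this puts an interval between
  neighbouring orbit points inside one lap. The wanted interval starts at the last point of
  \<open>U\<close> not exceeding \<open>u\<close>; the next point of \<open>U\<close> is beyond
  \<open>u\<close> and outside the gap, hence at least \<open>v\<close>. The bounds \<open>l\<close>
  and \<open>r\<close> ensure that both points exist.\<close>

lemma consecutive_intervals_cover_gap:
  assumes "finite U" "u < v" "U \<inter> {u<..<v} = {}" "l \<in> U" "l \<le> u" "r \<in> U" "v \<le> r"
  obtains L where "L \<in> set (consecutive_intervals U)" "{u..v} \<subseteq> L"
proof -
  let ?s = "sorted_list_of_set U"
  have len: "length ?s = card U" and set: "set ?s = U"
    using assms(1) by auto
  let ?K = "{k. k < card U \<and> ?s ! k \<le> u}"
  obtain k0 where "k0 < card U" "?s ! k0 = l"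
    using sorted_list_of_set_index[OF assms(1,4)] .
  with assms(5) have ne: "?K \<noteq> {}" by auto
  define k where "k = Max ?K"
  have "finite ?K" by simp
  have k: "k < card U" "?s ! k \<le> u"
    using Max_in[OF \<open>finite ?K\<close> ne] by (auto simp: k_def)
  obtain k1 where k1: "k1 < card U" "?s ! k1 = r"
    using sorted_list_of_set_index[OF assms(1,6)] .
  \<comment> \<open>Otherwise \<open>r\<close> would be at most the \<open>k\<close>-th point, hence
    at most \<open>u\<close>, against \<open>u < v \<le> r\<close>. So the \<open>k\<close>-th point
    has a successor in the list.\<close>
  have "k < k1"
  proof (rule ccontr)
    assume "\<not> k < k1"
    then have "?s ! k1 \<le> ?s ! k" using k len by (simp add: sorted_nth_mono)
    then show False using k k1 assms by linarith
  qed
  then have Sk: "Suc k < card U" using k1 by linarith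
  have "\<not> ?s ! Suc k \<le> u"
  proof
    assume "?s ! Suc k \<le> u"
    with Sk have "Suc k \<in> ?K" by blast
    then have "Suc k \<le> k"
      unfolding k_def using Max_ge[OF \<open>finite ?K\<close>] by blast
    then show False by simp
  qed
  moreover have "?s ! Suc k \<in> U"
    using Sk set len nth_mem[of "Suc k" ?s] by simp
  ultimately have "v \<le> ?s ! Suc k" using assms(3) by force
  show ?thesis
  proof
    show "{?s ! k .. ?s ! Suc k} \<in> set (consecutive_intervals U)"
      using Sk nth_mem[of k "consecutive_intervals U"]
      by (simp add: nth_consecutive_intervals length_consecutive_intervals)
    show "{u..v} \<subseteq> {?s ! k .. ?s ! Suc k}"
      using k \<open>v \<le> ?s ! Suc k\<close> by auto
  qed
qed

lemma interior_consecutive_intervals_disjoint: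
  assumes "finite S" "i < length (consecutive_intervals S)" "j < length (consecutive_intervals S)"
    "i \<noteq> j"
  shows "interior (consecutive_intervals S ! i) \<inter> interior (consecutive_intervals S ! j) = {}"
  using assms
proof (induction i j rule: linorder_wlog)
  case (le i j)
  let ?s = "sorted_list_of_set S"
  have ij: "i < card S - 1" "j < card S - 1" "Suc i \<le> j"
    using le by (auto simp: length_consecutive_intervals)
  \<comment> \<open>The right end of the \<open>i\<close>-th interval is at or before the left end
    of the \<open>j\<close>-th, so the two share at most an endpoint.\<close>
  then have "?s ! Suc i \<le> ?s ! j"
    using \<open>finite S\<close> by (simp add: sorted_nth_mono)
  with ij show ?case
    by (auto simp: nth_consecutive_intervals)
next
  case (sym i j)
  then show ?case by (metis Int_commute)
qed

section \<open>Markov partitions of interval maps from finite invariant sets\<close>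

lemma strictly_monotone_image_interval:
  fixes F :: "real \<Rightarrow> real"
  assumes "u < v" "continuous_on {u..v} F"
    "strict_mono_on {u..v} F \<or> strict_antimono_on {u..v} F"
  shows "F ` {u..v} = {min (F u) (F v)..max (F u) (F v)}"
proof -
  have "inj_on F {u..v}"
    using assms(3) unfolding inj_on_def monotone_on_def by (metis linorder_neqE less_irrefl)
  \<comment> \<open>\<open>closed_segment\<close> ignores the order of its endpoints, so the
    increasing and the decreasing case are handled together.\<close>
  then have "F ` closed_segment u v = closed_segment (F u) (F v)"
    using assms(1,2) by (intro continuous_injective_image_segment_1) (auto simp: closed_segment_eq_real_ivl)
  then show ?thesis
    using assms(1) by (auto simp: closed_segment_eq_real_ivl min_def max_def)
qed

lemma is_markov_partition_consecutive_intervals: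
  fixes F :: "real \<Rightarrow> real"
  assumes "finite S" "F ` S \<subseteq> S"
    and mono: "\<And>u v. \<lbrakk>u \<in> S; v \<in> S; u < v; S \<inter> {u<..<v} = {}\<rbrakk> \<Longrightarrow>
      continuous_on {u..v} F \<and> (strict_mono_on {u..v} F \<or> strict_antimono_on {u..v} F)"
  shows "is_markov_partition F (consecutive_intervals S)"
  unfolding is_markov_partition_def
proof (intro conjI allI impI)
  let ?R = "consecutive_intervals S"
  fix i j assume i: "i < length ?R" and j: "j < length ?R"
  show "interior (?R ! i) \<inter> interior (?R ! j) = {}" if "i \<noteq> j"
    using interior_consecutive_intervals_disjoint assms(1) i j that by blast
  obtain u v where uv: "?R ! i = {u..v}" "u \<in> S" "v \<in> S" "u < v" "S \<inter> {u<..<v} = {}"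
    using consecutive_intervals_nth_obtain[OF assms(1) i] .
  obtain w z where wz: "?R ! j = {w..z}" "w \<in> S" "z \<in> S" "w < z" "S \<inter> {w<..<z} = {}"
    using consecutive_intervals_nth_obtain[OF assms(1) j] .
  define l r where "l = min (F u) (F v)" and "r = max (F u) (F v)"
  have img: "F ` (?R ! i) = {l..r}"
    using strictly_monotone_image_interval mono uv by (simp add: l_def r_def)
  have "l \<in> S" "r \<in> S"
    using uv assms(2) by (auto simp: l_def r_def min_def max_def)
  \<comment> \<open>The ends of the image are points of \<open>S\<close>, and none of these lies
    strictly between \<open>w\<close> and \<open>z\<close>. So the image contains
    \<open>{w..z}\<close> when \<open>l \<le> w\<close> and \<open>z \<le> r\<close>, and otherwise
    lies wholly to one side of it, up to an endpoint.\<close>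
  then have "l \<le> w \<or> z \<le> l" "r \<le> w \<or> z \<le> r"
    using wz(5) by force+
  then show "?R ! j \<subseteq> F ` (?R ! i) \<or> interior (F ` (?R ! i)) \<inter> interior (?R ! j) = {}"
    unfolding img wz(1) by auto
qed

text \<open>Stated for a finite invariant set rather than one orbit, so that it applies both to
  \<open>P\<close> and to the union of the orbits \<open>Q k\<close>.\<close>

lemma modal_is_markov_partition:
  assumes modal: "modal m F a b" and S: "finite S" "F ` S \<subseteq> S" "S \<subseteq> {a..b}"
    and turning: "turning_points F a b \<subseteq> S"
  shows "is_markov_partition F (consecutive_intervals S)"
proof (rule is_markov_partition_consecutive_intervals[OF S(1,2)])
  fix u v assume uv: "u \<in> S" "v \<in> S" "u < v" "S \<inter> {u<..<v} = {}"
  let ?U = "{a, b} \<union> turning_points F a b"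
  have ab: "a \<le> u" "v \<le> b" using uv S(3) by auto
  have "finite ?U" using modal by (simp add: modal_def)
  \<comment> \<open>Turning points lie in \<open>S\<close> and so avoid the gap; \<open>a\<close>
    and \<open>b\<close> avoid it because \<open>u\<close> and \<open>v\<close> lie in
    \<open>{a..b}\<close>.\<close>
  moreover have "?U \<inter> {u<..<v} = {}" using uv ab turning by auto
  ultimately obtain L where L: "L \<in> set (consecutive_intervals ?U)" "{u..v} \<subseteq> L"
    using consecutive_intervals_cover_gap[of ?U u v a b] uv ab by blast
  have "strict_mono_on L F \<or> strict_antimono_on L F"
    using modal L(1) by (simp add: modal_def)
  then have "strict_mono_on {u..v} F \<or> strict_antimono_on {u..v} F"
    using L(2) monotone_on_subset by blast
  moreover have "continuous_on {u..v} F"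
    using modal ab unfolding modal_def continuous_self_map_def
    by (meson atLeastatMost_subset_iff continuous_on_subset)
  ultimately show "continuous_on {u..v} F \<and>
      (strict_mono_on {u..v} F \<or> strict_antimono_on {u..v} F)"
    by blast
qed

section \<open>Periodic orbits\<close>

lemma periodic_orbit_finite: "periodic_orbit F p P \<Longrightarrow> finite P"
  by (auto simp: periodic_orbit_def)

lemma periodic_orbit_image_subset:
  assumes "periodic_orbit F p P"
  shows "F ` P \<subseteq> P"
  using assms by (auto simp: periodic_orbit_def orbit_labelling_def)

text \<open>\<open>periodic_orbit\<close> does not mention the interval on which the map acts.
  Iterating from a single point known to lie in the interval runs through the whole orbit and so
  confines it there.\<close>

lemma periodic_orbit_subset_invariant:
  assumes "periodic_orbit F p P" "z \<in> P" "z \<in> S" "F ` S \<subseteq> S"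
  shows "P \<subseteq> S"
proof -
  obtain x where p: "0 < p" and step: "\<And>i. i < p \<Longrightarrow> F (x i) = x (Suc i mod p)"
    and P: "P = x ` {..<p}"
    using assms(1) by (auto simp: periodic_orbit_def orbit_labelling_def)
  obtain k where k: "k < p" "z = x k" using assms(2) P by auto
  have reach: "x ((k + n) mod p) \<in> S" for n
  proof (induction n)
    case 0
    then show ?case using k assms(3) by simp
  next
    case (Suc n)
    then have "F (x ((k + n) mod p)) \<in> S" using assms(4) by auto
    then show ?case using step[of "(k + n) mod p"] p by (simp add: mod_Suc_eq)
  qed
  \<comment> \<open>Starting from index \<open>k\<close>, \<open>p - k + i\<close> steps lead to
    \<open>p + i\<close>, which is \<open>i\<close> modulo \<open>p\<close>.\<close>
  have "x i \<in> S" if "i < p" for i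
    using reach[of "p - k + i"] k that by (simp add: add.assoc[symmetric])
  then show ?thesis using P by auto
qed

section \<open>Products of partitions and the Kronecker product\<close>

lemma product_partition_Cons:
  "product_partition Xs (Y # Ys) = map (\<lambda>X. X \<times> Y) Xs @ product_partition Xs Ys"
  by (simp add: product_partition_def)

lemma length_product_partition: "length (product_partition Xs Ys) = length Ys * length Xs"
  by (induction Ys) (simp_all add: product_partition_def)

text \<open>The \<open>Xs\<close> index runs fastest, so it is the remainder and the
  \<open>Ys\<close> index the quotient. \<open>kronecker\<close> splits its indices in the same way,
  which is why the matrix of the second coordinate becomes the left factor.\<close>

lemma nth_product_partition:
  assumes "k < length Ys * length Xs"
  shows "product_partition Xs Ys ! k = Xs ! (k mod length Xs) \<times> Ys ! (k div length Xs)"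
  using assms
proof (induction Ys arbitrary: k)
  case Nil
  then show ?case by simp
next
  case (Cons Y Ys)
  show ?case
  proof (cases "k < length Xs")
    case True
    then show ?thesis by (simp add: product_partition_Cons nth_append)
  next
    case False
    moreover have "0 < length Xs" using Cons.prems by (cases Xs) auto
    ultimately show ?thesis
      using Cons.IH[of "k - length Xs"] Cons.prems
      by (simp add: product_partition_Cons nth_append le_mod_geq le_div_geq)
  qed
qed

lemma div_mod_less_mult:
  fixes k :: nat
  assumes "k < n * l"
  shows "k div l < n" "k mod l < l"
  using assms by (auto simp: less_mult_imp_div_less intro!: mod_less_divisor gr0I)

lemma div_mod_neq:
  fixes i j l :: nat
  assumes "i \<noteq> j"
  shows "i div l \<noteq> j div l \<or> i mod l \<noteq> j mod l"
  using assms by (metis div_mult_mod_eq)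

lemma map_prod_times_image: "map_prod F G ` (A \<times> B) = F ` A \<times> G ` B"
  by auto

text \<open>A product map sends rectangles to rectangles, and interiors of rectangles are products
  of interiors. Covering in both coordinates gives covering of the rectangle, while missing in one
  coordinate already makes the interiors disjoint. Likewise, distinct rectangles differ in at least
  one coordinate interval.\<close>

lemma is_markov_partition_product:
  assumes F: "is_markov_partition F Xs" and G: "is_markov_partition G Ys"
  shows "is_markov_partition (map_prod F G) (product_partition Xs Ys)"
  unfolding is_markov_partition_def length_product_partition
proof (intro conjI allI impI)
  fix i j assume i: "i < length Ys * length Xs" and j: "j < length Ys * length Xs"
  let ?l = "length Xs"
  note less = div_mod_less_mult[OF i] div_mod_less_mult[OF j]
  note nth = nth_product_partition[OF i] nth_product_partition[OF j]
  show "interior (product_partition Xs Ys ! i) \<inter> interior (product_partition Xs Ys ! j) = {}"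
    if "i \<noteq> j"
    using F G less div_mod_neq[OF that, of ?l]
    unfolding is_markov_partition_def nth interior_Times Times_Int_Times by blast
  have "Xs ! (j mod ?l) \<subseteq> F ` (Xs ! (i mod ?l)) \<or>
      interior (F ` (Xs ! (i mod ?l))) \<inter> interior (Xs ! (j mod ?l)) = {}"
    using F less unfolding is_markov_partition_def by blast
  moreover have "Ys ! (j div ?l) \<subseteq> G ` (Ys ! (i div ?l)) \<or>
      interior (G ` (Ys ! (i div ?l))) \<inter> interior (Ys ! (j div ?l)) = {}"
    using G less unfolding is_markov_partition_def by blast
  ultimately show "product_partition Xs Ys ! j \<subseteq> map_prod F G ` (product_partition Xs Ys ! i) \<or>
      interior (map_prod F G ` (product_partition Xs Ys ! i)) \<inter>
        interior (product_partition Xs Ys ! j) = {}"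
    unfolding nth map_prod_times_image interior_Times Times_Int_Times by blast
qed

text \<open>A product of two sets is nonempty exactly when both factors are, so each 0/1 entry is
  the product of the entries for the two coordinates.\<close>

lemma transition_matrix_product:
  "transition_matrix (map_prod F G) (product_partition Xs Ys) =
    kronecker (transition_matrix G Ys) (transition_matrix F Xs)"
proof (rule eq_matI)
  fix i j
  assume "i < dim_row (kronecker (transition_matrix G Ys) (transition_matrix F Xs))"
    and "j < dim_col (kronecker (transition_matrix G Ys) (transition_matrix F Xs))"
  then have i: "i < length Ys * length Xs" and j: "j < length Ys * length Xs"
    by (simp_all add: kronecker_def transition_matrix_def)
  show "transition_matrix (map_prod F G) (product_partition Xs Ys) $$ (i, j) =
    kronecker (transition_matrix G Ys) (transition_matrix F Xs) $$ (i, j)"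
    using i j div_mod_less_mult[OF i] div_mod_less_mult[OF j]
    by (simp add: transition_matrix_def kronecker_def length_product_partition
        nth_product_partition map_prod_times_image interior_Times Times_Int_Times)
qed (simp_all add: transition_matrix_def kronecker_def length_product_partition)

section \<open>Application to the basis map and the fiber composition\<close>

theorem theorem3p1:
  fixes f :: "real \<Rightarrow> real" and g :: "real \<Rightarrow> real \<Rightarrow> real"
    and a b c d :: real
    and p m :: nat and q :: "nat \<Rightarrow> nat"
    and x e :: "nat \<Rightarrow> real" and P :: "real set" and Q :: "nat \<Rightarrow> real set"
    and gP :: "real \<Rightarrow> real" and TP :: "real \<times> real \<Rightarrow> real \<times> real"
    and Rx Ry :: "real set list"
  assumes "a \<le> b" and "c \<le> d"
    and "continuous_self_map ({a..b} \<times> {c..d}) (triangular f g)"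
    and "unimodal f a b"
    and "orbit_labelling f p x" and "P = x ` {..<p}"
    and "turning_points f a b \<subseteq> P"
    and "gP = fiber_composition g p x"
    and "modal m gP c d"
    and "bij_betw e {..<m} (turning_points gP c d)"
    and "\<And>k. k < m \<Longrightarrow> periodic_orbit gP (q k) (Q k) \<and> e k \<in> Q k"
    and "Rx = consecutive_intervals P"
    and "Ry = consecutive_intervals (\<Union>k<m. Q k)"
    and "TP = map_prod f gP"
  shows "is_markov_partition TP (product_partition Rx Ry) \<and>
    transition_matrix TP (product_partition Rx Ry) =
      kronecker (transition_matrix gP Ry) (transition_matrix f Rx)"
proof -
  have P: "periodic_orbit f p P"
    using assms(5,6) by (auto simp: periodic_orbit_def)
  have "card (turning_points f a b) = 1"
    using assms(4) by (simp add: modal_def)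
  \<comment> \<open>The turning point is an interior point of \<open>{a..b}\<close> on
    \<open>P\<close>, so it anchors the orbit in the interval.\<close>
  then obtain z where z: "z \<in> turning_points f a b"
    by (metis card.empty equals0I zero_neq_one)
  then have "z \<in> {a..b}" by (auto simp: turning_points_def)
  moreover have "f ` {a..b} \<subseteq> {a..b}"
    using assms(4) by (simp add: modal_def continuous_self_map_def)
  ultimately have "P \<subseteq> {a..b}"
    using periodic_orbit_subset_invariant[OF P] z assms(7) by blast
  then have Rx: "is_markov_partition f Rx"
    unfolding assms(12) using modal_is_markov_partition[OF assms(4)] assms(7)
      periodic_orbit_finite[OF P] periodic_orbit_image_subset[OF P] by blast

  let ?Q = "\<Union>k<m. Q k"
  have gP: "gP ` {c..d} \<subseteq> {c..d}"
    using assms(9) by (simp add: modal_def continuous_self_map_def)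
  have e: "turning_points gP c d = e ` {..<m}"
    using assms(10) by (simp add: bij_betw_def)
  \<comment> \<open>Each \<open>Q k\<close> is anchored in \<open>{c..d}\<close> by its own turning
    point \<open>e k\<close>.\<close>
  have "Q k \<subseteq> {c..d}" if "k < m" for k
  proof -
    have "e k \<in> turning_points gP c d" using that e by blast
    then have "e k \<in> {c..d}" by (auto simp: turning_points_def)
    then show ?thesis
      using periodic_orbit_subset_invariant gP assms(11)[OF that] by blast
  qed
  then have "?Q \<subseteq> {c..d}" by blast
  moreover have "finite ?Q"
    using assms(11) periodic_orbit_finite by blast
  moreover have "gP ` ?Q \<subseteq> ?Q"
    unfolding image_UN using assms(11) by (intro UN_mono order_refl periodic_orbit_image_subset) auto
  \<comment> \<open>\<open>e\<close> enumerates all turning points, and \<open>e k\<close> lies on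
    \<open>Q k\<close>, so the union of the orbits misses none of them.\<close>
  moreover have "turning_points gP c d \<subseteq> ?Q"
    unfolding e using assms(11) by (intro image_subsetI UN_I) auto
  ultimately have Ry: "is_markov_partition gP Ry"
    unfolding assms(13) by (intro modal_is_markov_partition[OF assms(9)])

  show ?thesis
    unfolding assms(14)
    by (intro conjI is_markov_partition_product[OF Rx Ry] transition_matrix_product)
qed

end
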